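(* Let $X=\{X_i:i\ge1\}$ be a sequence of i.i.d. random variables with values in a measurable space $(E,\mathcal{E})$. Let $m\ge1$ be a fixed integer and let $\{h_n:n\ge1\}$ be a sequence of jointly measurable symmetric kernels $h_n:E^m\to\mathbb{R}$ such that $\mathbb{E}[h_n(X_1,\dots,X_m)]=0$ and $\mathbb{E}[h_n(X_1,\dots,X_m)^2]<\infty$. Let $\{N(n):n\ge1\}$ be a sequence of Poisson random variables independent of $X$ such that $N(n)$ has mean $n$ for every $n$. For $n\ge m$ put $$U_n=\sum_{1\le i_1,\dots,i_m\le N(n)}h_n(X_{i_1},\dots,X_{i_m}),\qquad U_n'=\sum_{1\le i_1,\dots,i_m\le n}h_n(X_{i_1},\dots,X_{i_m}),$$ where both sums run over all $m$-tuples $(i_1,\dots,i_m)$ such that $i_j\ne i_k$ for $j\ne k$. Assume that $\mathbb{E}[U_n^2]\to1$ as $n\to\infty$. Then $\mathbb{E}[U_n'^2]\to1$ and $$\mathbb{E}\left[(U_n-U_n')^2\right]=O(n^{-1/2}),\qquad n\to\infty.$$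
   Context: No further definitions are needed beyond those in the claim. *)

theory Defs
  imports "HOL-Probability.Probability" "HOL-Library.Landau_Symbols"
begin

text \<open>
  Points of the \<open>m\<close>-fold product of a measurable space \<open>S\<close> are represented by functions that are
  extensional on \<open>{1..m}\<close>, i.e. by elements of \<open>space (PiM {1..m} (\<lambda>_. S))\<close>; joint measurability
  refers to the product sigma-algebra.
\<close>

definition symmetric_kernel :: "'e measure \<Rightarrow> nat \<Rightarrow> ((nat \<Rightarrow> 'e) \<Rightarrow> real) \<Rightarrow> bool" where
  "symmetric_kernel S m h \<longleftrightarrow>
     h \<in> borel_measurable (PiM {1..m} (\<lambda>_. S)) \<and>
     (\<forall>\<pi> x. \<pi> permutes {1..m} \<longrightarrow> x \<in> space (PiM {1..m} (\<lambda>_. S)) \<longrightarrow>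
        h (\<lambda>j\<in>{1..m}. x (\<pi> j)) = h x)"

definition distinct_tuples :: "nat \<Rightarrow> nat \<Rightarrow> (nat \<Rightarrow> nat) set" where
  "distinct_tuples m k = {i \<in> {1..m} \<rightarrow>\<^sub>E {1..k}. \<forall>j\<in>{1..m}. \<forall>l\<in>{1..m}. j \<noteq> l \<longrightarrow> i j \<noteq> i l}"

text \<open>
  The sum of \<open>h (x i\<^sub>1, \<dots>, x i\<^sub>m)\<close> over all ordered \<open>m\<close>-tuples of distinct indices in \<open>{1..k}\<close>,
  without normalization; it is \<open>0\<close> for \<open>k < m\<close>.
\<close>

definition U_sum :: "nat \<Rightarrow> ((nat \<Rightarrow> 'e) \<Rightarrow> real) \<Rightarrow> (nat \<Rightarrow> 'e) \<Rightarrow> nat \<Rightarrow> real" where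
  "U_sum m h x k = (\<Sum>i\<in>distinct_tuples m k. h (\<lambda>j\<in>{1..m}. x (i j)))"

text \<open>
  \<^const>\<open>prob_space.indep_var\<close> requires both random variables to have the same value type, so
  independence of two random variables of different types is expressed through independence of the
  generated sigma-algebras.
\<close>

definition indep_rvs ::
  "'w measure \<Rightarrow> 'a measure \<Rightarrow> ('w \<Rightarrow> 'a) \<Rightarrow> 'b measure \<Rightarrow> ('w \<Rightarrow> 'b) \<Rightarrow> bool" where
  "indep_rvs M A Y B Z \<longleftrightarrow>
     Y \<in> measurable M A \<and> Z \<in> measurable M B \<and>
     prob_space.indep_set M {Y -` a \<inter> space M | a. a \<in> sets A} {Z -` b \<inter> space M | b. b \<in> sets B}"

end

theory Submission
  imports Defs
begin

text \<open>
  Write \<open>W k\<close> for the sum over the tuples of distinct indices up to \<open>k\<close>, with a fixed kernel \<open>h\<close>.  The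
  expectation of a product \<open>h (X i) * h (X i')\<close> over two tuples depends only on the number \<open>q\<close> of
  indices that the tuples share, by symmetry of \<open>h\<close> and exchangeability of \<open>X\<close> (lemma
  \<open>expectation_overlap\<close>).  Call it \<open>c q\<close>.  Counting pairs of tuples by overlap gives, for \<open>k \<le> l\<close>,

    \<open>E (W k * W l) = (\<Sum>q\<le>m. c q * m!\<^sup>2 * (m choose q) * (k choose m) * ((l - m) choose (m - q)))\<close>.

  All \<open>c q\<close> are nonnegative (lemma \<open>overlap_moment_nonneg\<close>), so the whole proof can work term by term in
  \<open>q\<close>, with the coefficients \<open>c q\<close> left unspecified.

  For \<open>k = l\<close> the product of the two binomial coefficients containing \<open>k\<close> is, up to a constant,
  \<open>k choose (2 * m - q)\<close>, whose expectation under a Poisson variable with mean \<open>n\<close> is exactly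
  \<open>n ^ (2 * m - q) / (2 * m - q)!\<close>.  Thus the second moment of the Poissonized statistic is a sum of
  nonnegative terms, each one \<open>c q\<close> times the leading term of the corresponding count.  Replacing the count at
  \<open>(k, k)\<close> by the count at \<open>(k, n)\<close> or \<open>(n, n)\<close> lowers the leading term by a relative amount of at most a
  constant times \<open>(1 + \<bar>k - n\<bar>) / n\<close> (lemma \<open>overlap_count_lower_bound\<close>), and the mean absolute deviation of
  the Poisson variable is at most \<open>sqrt n\<close>.  Consequently, with \<open>A\<close> the second moment of the
  Poissonized statistic,

    \<open>(1 - 4 * m\<^sup>2 / n) * A \<le> E ((W n)\<^sup>2) \<le> A\<close>

  and the mean square distance between the two statistics is at most
  \<open>4 * m * (2 * m + 1) * A / sqrt n\<close> (lemmas \<open>fixed_mean_square\<close> and \<open>poisson_fixed_distance\<close>).  These bounds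
  hold for every \<open>n \<ge> m\<close>, with the kernel belonging to \<open>n\<close>; letting \<open>A\<close> tend to \<open>1\<close> gives both claims.
\<close>

section \<open>Counting tuples of distinct indices\<close>

lemma distinct_tuples_eq:
  "distinct_tuples m k = {i \<in> {1..m} \<rightarrow>\<^sub>E {1..k}. inj_on i {1..m}}"
  unfolding distinct_tuples_def inj_on_def by blast

lemma distinct_tuples_alt:
  "distinct_tuples m k = {i \<in> extensional {1..m}. inj_on i {1..m} \<and> i ` {1..m} \<subseteq> {1..k}}"
  unfolding distinct_tuples_eq PiE_def by blast

lemma finite_distinct_tuples [simp]: "finite (distinct_tuples m k)"
  unfolding distinct_tuples_eq by (rule finite_subset[OF _ finite_PiE[of "{1..m}" "\<lambda>_. {1..k}"]]) auto

lemma distinct_tuplesD: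
  assumes "i \<in> distinct_tuples m k"
  shows "inj_on i {1..m}" "i ` {1..m} \<subseteq> {1..k}" "card (i ` {1..m}) = m" "i \<in> {1..m} \<rightarrow> {1..k}"
  using assms by (auto simp: distinct_tuples_eq card_image PiE_iff)

text \<open>
  Fixing one enumeration of \<open>B\<close>, all the others arise from it by a permutation of the indices.
\<close>

lemma card_enumerations:
  fixes B :: "'a set"
  assumes "finite B" "card B = m"
  shows "card {i \<in> extensional {1..m}. inj_on i {1..m} \<and> i ` {1..m} = B} = fact m"
proof -
  obtain e where e: "bij_betw e {1..m} B"
    using finite_same_card_bij[of "{1..m}" B] assms by auto
  let ?E = "{i \<in> extensional {1..m}. inj_on i {1..m} \<and> i ` {1..m} = B}"
  have "bij_betw (\<lambda>\<pi>. \<lambda>j\<in>{1..m}. e (\<pi> j)) {\<pi>. \<pi> permutes {1..m}} ?E"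
    unfolding bij_betw_def
  proof
    show "inj_on (\<lambda>\<pi>. \<lambda>j\<in>{1..m}. e (\<pi> j)) {\<pi>. \<pi> permutes {1..m}}"
    proof (rule inj_onI)
      fix p q assume p: "p \<in> {\<pi>. \<pi> permutes {1..m}}" and q: "q \<in> {\<pi>. \<pi> permutes {1..m}}"
        and eq: "(\<lambda>j\<in>{1..m}. e (p j)) = (\<lambda>j\<in>{1..m}. e (q j))"
      show "p = q"
      proof
        fix j show "p j = q j"
        proof (cases "j \<in> {1..m}")
          case True
          with fun_cong[OF eq, of j] have "e (p j) = e (q j)" by simp
          moreover have "p j \<in> {1..m}" "q j \<in> {1..m}"
            using p q True by (auto simp only: mem_Collect_eq permutes_in_image)
          ultimately show ?thesis using e by (auto simp only: bij_betw_def inj_on_def)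
        next
          case False
          have "p j = j" "q j = j"
            using p q False by (simp_all del: atLeastAtMost_iff add: permutes_not_in)
          thus ?thesis by simp
        qed
      qed
    qed
  next
    show "(\<lambda>\<pi>. \<lambda>j\<in>{1..m}. e (\<pi> j)) ` {\<pi>. \<pi> permutes {1..m}} = ?E"
    proof (intro equalityI subsetI)
      fix i assume "i \<in> (\<lambda>\<pi>. \<lambda>j\<in>{1..m}. e (\<pi> j)) ` {\<pi>. \<pi> permutes {1..m}}"
      then obtain p where p: "p permutes {1..m}" and i: "i = (\<lambda>j\<in>{1..m}. e (p j))" by auto
      have "bij_betw (e \<circ> p) {1..m} B"
        using permutes_imp_bij[OF p] e by (rule bij_betw_trans)
      hence "bij_betw i {1..m} B"
        by (subst bij_betw_cong[of _ _ "e \<circ> p"]) (auto simp: i)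
      thus "i \<in> ?E" by (auto simp: bij_betw_def i)
    next
      fix i assume i: "i \<in> ?E"
      define p where "p = (\<lambda>j. if j \<in> {1..m} then inv_into {1..m} e (i j) else j)"
      have "bij_betw (inv_into {1..m} e \<circ> i) {1..m} {1..m}"
        using i bij_betw_inv_into[OF e] by (intro bij_betw_trans[of i _ B]) (auto simp: bij_betw_def)
      hence "bij_betw p {1..m} {1..m}"
        by (subst bij_betw_cong[of _ _ "inv_into {1..m} e \<circ> i"]) (auto simp: p_def)
      hence p: "p permutes {1..m}"
        by (rule bij_imp_permutes) (auto simp: p_def)
      have "i = (\<lambda>j\<in>{1..m}. e (p j))"
      proof
        fix j show "i j = (\<lambda>j\<in>{1..m}. e (p j)) j"
        proof (cases "j \<in> {1..m}")
          case True
          hence "i j \<in> B" using i by blast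
          thus ?thesis using True bij_betw_inv_into_right[OF e] by (simp add: p_def)
        next
          case False
          have "i \<in> extensional {1..m}" using i by blast
          from extensional_arb[OF this False] show ?thesis by (simp only: restrict_apply False if_False)
        qed
      qed
      with p show "i \<in> (\<lambda>\<pi>. \<lambda>j\<in>{1..m}. e (\<pi> j)) ` {\<pi>. \<pi> permutes {1..m}}" by blast
    qed
  qed
  hence "card ?E = card {\<pi>. \<pi> permutes {1..m}}" by (rule bij_betw_same_card[symmetric])
  thus ?thesis using card_permutations[of "{1..m}" m] by simp
qed

text \<open>
  Properties of a tuple that depend only on its set of entries are counted on \<open>m\<close>-subsets.
\<close>

lemma card_distinct_tuples_image:
  "card {i \<in> distinct_tuples m l. P (i ` {1..m})}
     = fact m * card {B. B \<subseteq> {1..l} \<and> card B = m \<and> P B}"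
proof -
  let ?Bs = "{B. B \<subseteq> {1..l} \<and> card B = m \<and> P B}"
  let ?E = "\<lambda>B. {i \<in> extensional {1..m}. inj_on i {1..m} \<and> i ` {1..m} = B}"
  have fin: "finite ?Bs" by (rule finite_subset[of _ "Pow {1..l}"]) auto
  have fB: "finite B" if "B \<in> ?Bs" for B using that finite_subset[of B "{1..l}"] by auto
  have fE: "finite (?E B)" if "B \<in> ?Bs" for B
    using card_enumerations[OF fB[OF that], of m] that by (intro card_ge_0_finite) simp
  have split: "{i \<in> distinct_tuples m l. P (i ` {1..m})} = (\<Union>B\<in>?Bs. ?E B)"
  proof (rule set_eqI)
    fix i :: "nat \<Rightarrow> nat"
    have card: "inj_on i {1..m} \<Longrightarrow> card (i ` {1..m}) = m"
      by (drule card_image) simp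
    show "i \<in> {i \<in> distinct_tuples m l. P (i ` {1..m})} \<longleftrightarrow> i \<in> (\<Union>B\<in>?Bs. ?E B)"
    proof
      assume "i \<in> {i \<in> distinct_tuples m l. P (i ` {1..m})}"
      hence "i ` {1..m} \<in> ?Bs" "i \<in> ?E (i ` {1..m})"
        using card unfolding distinct_tuples_alt mem_Collect_eq by simp_all
      thus "i \<in> (\<Union>B\<in>?Bs. ?E B)" by (rule UN_I)
    next
      assume "i \<in> (\<Union>B\<in>?Bs. ?E B)"
      then obtain B where "B \<in> ?Bs" "i \<in> ?E B" by (rule UN_E)
      thus "i \<in> {i \<in> distinct_tuples m l. P (i ` {1..m})}"
        unfolding distinct_tuples_alt mem_Collect_eq by simp
    qed
  qed
  have "card (\<Union>B\<in>?Bs. ?E B) = (\<Sum>B\<in>?Bs. card (?E B))"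
  proof (rule card_UN_disjoint[OF fin])
    show "\<forall>B\<in>?Bs. finite (?E B)" using fE by (intro ballI)
    show "\<forall>B\<in>?Bs. \<forall>B'\<in>?Bs. B \<noteq> B' \<longrightarrow> ?E B \<inter> ?E B' = {}" 
    proof (intro ballI impI equals0I)
      fix B B' and i :: "nat \<Rightarrow> nat" assume "B \<noteq> B'" and i: "i \<in> ?E B \<inter> ?E B'"
      from i have "i ` {1..m} = B" by (elim IntE CollectE conjE)
      moreover from i have "i ` {1..m} = B'" by (elim IntE CollectE conjE)
      ultimately have "B = B'" by (rule trans[OF sym])
      with \<open>B \<noteq> B'\<close> show False ..
    qed
  qed
  also have "\<dots> = (\<Sum>B\<in>?Bs. fact m)"
  proof (rule sum.cong[OF refl])
    fix B assume B: "B \<in> ?Bs"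
    hence "card B = m" by (elim CollectE conjE)
    thus "card (?E B) = fact m" by (rule card_enumerations[OF fB[OF B]])
  qed
  finally show ?thesis by (simp only: split sum_constant of_nat_id mult.commute)
qed

lemma card_distinct_tuples: "card (distinct_tuples m k) = fact m * (k choose m)"
  using card_distinct_tuples_image[of m k "\<lambda>_. True"] n_subsets[of "{1..k}" m] by simp

text \<open>
  A subset \<open>B\<close> is the same thing as the pair of its parts inside and outside \<open>A\<close>.
\<close>

lemma card_subsets_overlap:
  assumes "finite C" "A \<subseteq> C" "card A = m" "q \<le> m"
  shows "card {B. B \<subseteq> C \<and> card B = m \<and> card (A \<inter> B) = q}
           = (m choose q) * ((card C - m) choose (m - q))"
proof -
  have fA: "finite A" using assms finite_subset by blast
  let ?P = "{D. D \<subseteq> A \<and> card D = q} \<times> {D. D \<subseteq> C - A \<and> card D = m - q}"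
  have "bij_betw (\<lambda>B. (A \<inter> B, B - A)) {B. B \<subseteq> C \<and> card B = m \<and> card (A \<inter> B) = q} ?P"
  proof (rule bij_betwI[where g = "\<lambda>(D, F). D \<union> F"])
    show "(\<lambda>B. (A \<inter> B, B - A)) \<in> {B. B \<subseteq> C \<and> card B = m \<and> card (A \<inter> B) = q} \<rightarrow> ?P"
    proof (intro Pi_I)
      fix B assume B: "B \<in> {B. B \<subseteq> C \<and> card B = m \<and> card (A \<inter> B) = q}"
      have "card (B - A) = m - q"
        using B fA card_Diff_subset_Int[of B A] finite_subset[of B C] assms
        by (auto simp: Int_commute)
      with B show "(A \<inter> B, B - A) \<in> ?P" by auto
    qed
  next
    show "(\<lambda>(D, F). D \<union> F) \<in> ?P \<rightarrow> {B. B \<subseteq> C \<and> card B = m \<and> card (A \<inter> B) = q}"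
    proof (intro Pi_I)
      fix z assume "z \<in> ?P"
      then obtain D F where z: "z = (D, F)" "D \<subseteq> A" "card D = q" "F \<subseteq> C - A" "card F = m - q"
        by auto
      have "finite D" "finite F"
        using z fA assms(1) finite_subset[of D A] finite_subset[of F C] by auto
      moreover have "D \<inter> F = {}" "A \<inter> (D \<union> F) = D" using z by auto
      ultimately show "(\<lambda>(D, F). D \<union> F) z \<in> {B. B \<subseteq> C \<and> card B = m \<and> card (A \<inter> B) = q}"
        using z assms by (auto simp: card_Un_disjoint)
    qed
  next
    fix z assume "z \<in> ?P"
    thus "(\<lambda>B. (A \<inter> B, B - A)) ((\<lambda>(D, F). D \<union> F) z) = z" by blast
  qed blast
  hence "card {B. B \<subseteq> C \<and> card B = m \<and> card (A \<inter> B) = q} = card ?P"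
    by (rule bij_betw_same_card)
  also have "\<dots> = (m choose q) * ((card C - m) choose (m - q))"
    using assms fA by (simp add: card_cartesian_product n_subsets card_Diff_subset)
  finally show ?thesis .
qed

lemma card_distinct_tuples_overlap:
  assumes "i \<in> distinct_tuples m k" "k \<le> l" "q \<le> m"
  shows "card {i' \<in> distinct_tuples m l. card (i ` {1..m} \<inter> i' ` {1..m}) = q}
           = fact m * ((m choose q) * ((l - m) choose (m - q)))"
proof -
  have "i ` {1..m} \<subseteq> {1..l}" "card (i ` {1..m}) = m"
    using distinct_tuplesD(2,3)[OF assms(1)] assms(2) by (auto simp only: subset_iff atLeastAtMost_iff)
  thus ?thesis
    using card_distinct_tuples_image[of m l "\<lambda>B. card (i ` {1..m} \<inter> B) = q"]
      card_subsets_overlap[of "{1..l}" "i ` {1..m}" m q] assms(3) by simp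
qed

section \<open>Second moments of symmetric statistics of an i.i.d. sequence\<close>

locale iid_sequence = prob_space M for M :: "'w measure" +
  fixes S :: "'e measure" and X :: "nat \<Rightarrow> 'w \<Rightarrow> 'e"
  assumes X_indep: "indep_vars (\<lambda>_. S) X {1..}"
    and X_ident: "i \<ge> 1 \<Longrightarrow> distr M S (X i) = distr M S (X 1)"
begin

lemma X_measurable: "i \<ge> 1 \<Longrightarrow> X i \<in> measurable M S"
  using X_indep by (simp add: indep_vars_def)

text \<open>
  Exchangeability: picking distinct members of the sequence always gives the product law, whichever
  members are picked.  The joint law of the whole sequence is a product measure, and a selection of
  coordinates maps it to the product measure over the selected coordinates.
\<close>

lemma distr_selection:
  assumes "inj_on \<sigma> I" "\<sigma> \<in> I \<rightarrow> {1..}"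
  shows "distr M (PiM I (\<lambda>_. S)) (\<lambda>\<omega>. \<lambda>a\<in>I. X (\<sigma> a) \<omega>) = PiM I (\<lambda>_. distr M S (X 1))"
proof -
  let ?D = "distr M S (X 1)"
  let ?Q = "PiM {1..} (\<lambda>_::nat. ?D)"
  have joint: "distr M (PiM {1..} (\<lambda>_. S)) (\<lambda>\<omega>. \<lambda>i\<in>{1..}. X i \<omega>) = ?Q"
  proof -
    have "distr M (PiM {1..} (\<lambda>_. S)) (\<lambda>\<omega>. \<lambda>i\<in>{1..}. X i \<omega>) = PiM {1..} (\<lambda>i. distr M S (X i))"
      using indep_vars_iff_distr_eq_PiM'[where I = "{1::nat..}" and M' = "\<lambda>_. S" and X = X] X_indep X_measurable by auto
    also have "\<dots> = ?Q"
      by (rule PiM_cong[OF refl X_ident]) simp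
    finally show ?thesis .
  qed
  have "PiM I (\<lambda>_. ?D) = distr ?Q (PiM I (\<lambda>_. ?D)) (\<lambda>x. \<lambda>a\<in>I. x (\<sigma> a))"
    using assms prob_space_distr[OF X_measurable[of 1]]
    by (intro distr_PiM_reindex[symmetric, where M = "\<lambda>_. ?D"]) auto
  also have "\<dots> = distr (distr M (PiM {1..} (\<lambda>_. S)) (\<lambda>\<omega>. \<lambda>i\<in>{1..}. X i \<omega>))
                    (PiM I (\<lambda>_. S)) (\<lambda>x. \<lambda>a\<in>I. x (\<sigma> a))"
    unfolding joint by (rule distr_cong[OF refl sets_PiM_cong refl]) auto
  also have "\<dots> = distr M (PiM I (\<lambda>_. S)) ((\<lambda>x. \<lambda>a\<in>I. x (\<sigma> a)) \<circ> (\<lambda>\<omega>. \<lambda>i\<in>{1..}. X i \<omega>))"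
  proof (rule distr_distr)
    show "(\<lambda>x. \<lambda>a\<in>I. x (\<sigma> a)) \<in> measurable (PiM {1..} (\<lambda>_. S)) (PiM I (\<lambda>_. S))"
      using assms by (intro measurable_restrict measurable_component_singleton) auto
    show "(\<lambda>\<omega>. \<lambda>i\<in>{1..}. X i \<omega>) \<in> measurable M (PiM {1..} (\<lambda>_. S))"
      using X_measurable by (intro measurable_restrict) auto
  qed
  also have "(\<lambda>x. \<lambda>a\<in>I. x (\<sigma> a)) \<circ> (\<lambda>\<omega>. \<lambda>i\<in>{1..}. X i \<omega>) = (\<lambda>\<omega>. \<lambda>a\<in>I. X (\<sigma> a) \<omega>)"
    using assms(2) by (auto simp: fun_eq_iff restrict_def)
  finally show ?thesis ..
qed

lemma selection_measurable:
  "\<sigma> \<in> I \<rightarrow> {1..} \<Longrightarrow> (\<lambda>\<omega>. \<lambda>a\<in>I. X (\<sigma> a) \<omega>) \<in> measurable M (PiM I (\<lambda>_. S))"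
  using X_measurable by (intro measurable_restrict) auto

lemma
  fixes g :: "(nat \<Rightarrow> 'e) \<Rightarrow> real"
  assumes "inj_on \<sigma> I" "\<sigma> \<in> I \<rightarrow> {1..}" "I \<subseteq> {1..}" "g \<in> borel_measurable (PiM I (\<lambda>_. S))"
  shows expectation_selection:
      "expectation (\<lambda>\<omega>. g (\<lambda>a\<in>I. X (\<sigma> a) \<omega>)) = expectation (\<lambda>\<omega>. g (\<lambda>a\<in>I. X a \<omega>))"
    and integrable_selection:
      "integrable M (\<lambda>\<omega>. g (\<lambda>a\<in>I. X (\<sigma> a) \<omega>)) \<longleftrightarrow> integrable M (\<lambda>\<omega>. g (\<lambda>a\<in>I. X a \<omega>))"
proof -
  have id: "(\<lambda>a. a) \<in> I \<rightarrow> {1..}" using assms(3) by auto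
  have eq: "distr M (PiM I (\<lambda>_. S)) (\<lambda>\<omega>. \<lambda>a\<in>I. X (\<sigma> a) \<omega>)
         = distr M (PiM I (\<lambda>_. S)) (\<lambda>\<omega>. \<lambda>a\<in>I. X a \<omega>)"
    using distr_selection[OF assms(1,2)] distr_selection[OF _ id] by simp
  show "expectation (\<lambda>\<omega>. g (\<lambda>a\<in>I. X (\<sigma> a) \<omega>)) = expectation (\<lambda>\<omega>. g (\<lambda>a\<in>I. X a \<omega>))"
    using integral_distr[OF selection_measurable[OF assms(2)] assms(4)]
      integral_distr[OF selection_measurable[OF id] assms(4)] eq by simp
  show "integrable M (\<lambda>\<omega>. g (\<lambda>a\<in>I. X (\<sigma> a) \<omega>)) \<longleftrightarrow> integrable M (\<lambda>\<omega>. g (\<lambda>a\<in>I. X a \<omega>))"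
    using integrable_distr_eq[OF selection_measurable[OF assms(2)] assms(4)]
      integrable_distr_eq[OF selection_measurable[OF id] assms(4)] eq by simp
qed

end

text \<open>
  The two sets have the same position relative to each other as soon as their sizes and the size of
  their intersection agree: match the three parts of the Venn diagram separately.
\<close>

lemma overlap_transport:
  fixes A B C D :: "'a set"
  assumes "finite A" "finite B" "finite C" "finite D"
    and "card C = card A" "card D = card B" "card (C \<inter> D) = card (A \<inter> B)"
  obtains \<sigma> where "inj_on \<sigma> (A \<union> B)" "\<sigma> ` A = C" "\<sigma> ` B = D"
proof -
  obtain f where f: "bij_betw f (A \<inter> B) (C \<inter> D)"
    using assms by (metis finite_Int finite_same_card_bij)
  have "card (A - B) = card (C - D)" "card (B - A) = card (D - C)"
    using assms by (simp_all add: card_Diff_subset_Int Int_commute)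
  then obtain g k where g: "bij_betw g (A - B) (C - D)" and k: "bij_betw k (B - A) (D - C)"
    using assms by (metis finite_Diff finite_same_card_bij)
  define \<sigma> where "\<sigma> x = (if x \<in> A then if x \<in> B then f x else g x else k x)" for x
  have f': "bij_betw \<sigma> (A \<inter> B) (C \<inter> D)"
    using f by (subst bij_betw_cong[of _ _ f]) (auto simp: \<sigma>_def)
  have g': "bij_betw \<sigma> (A - B) (C - D)"
    using g by (subst bij_betw_cong[of _ _ g]) (auto simp: \<sigma>_def)
  have k': "bij_betw \<sigma> (B - A) (D - C)"
    using k by (subst bij_betw_cong[of _ _ k]) (auto simp: \<sigma>_def)
  have A: "bij_betw \<sigma> (A \<inter> B \<union> (A - B)) (C \<inter> D \<union> (C - D))"
    using f' g' by (rule bij_betw_combine) auto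
  have B: "bij_betw \<sigma> (A \<inter> B \<union> (B - A)) (C \<inter> D \<union> (D - C))"
    using f' k' by (rule bij_betw_combine) auto
  have "bij_betw \<sigma> (A \<inter> B \<union> (A - B) \<union> (B - A)) (C \<inter> D \<union> (C - D) \<union> (D - C))"
    using A k' by (rule bij_betw_combine) auto
  moreover have "A \<inter> B \<union> (A - B) = A" "C \<inter> D \<union> (C - D) = C" "A \<inter> B \<union> (B - A) = B"
    "C \<inter> D \<union> (D - C) = D" "A \<union> (B - A) = A \<union> B" by auto
  ultimately show ?thesis using A B by (intro that[of \<sigma>]) (auto simp: bij_betw_def)
qed

locale iid_kernel = iid_sequence M S X
  for M :: "'w measure" and S :: "'e measure" and X +
  fixes m :: nat and h :: "(nat \<Rightarrow> 'e) \<Rightarrow> real"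
  assumes kernel: "symmetric_kernel S m h"
    and square: "integrable M (\<lambda>\<omega>. (h (\<lambda>j\<in>{1..m}. X j \<omega>))\<^sup>2)"
begin

definition kernel_at :: "(nat \<Rightarrow> nat) \<Rightarrow> 'w \<Rightarrow> real" where
  "kernel_at i \<omega> = h (\<lambda>j\<in>{1..m}. X (i j) \<omega>)"

definition indices :: "(nat \<Rightarrow> nat) set" where
  "indices = {i. inj_on i {1..m} \<and> i \<in> {1..m} \<rightarrow> {1..}}"

lemma distinct_tuples_indices: "distinct_tuples m k \<subseteq> indices"
  using distinct_tuplesD(1,4)[of _ m k] by (fastforce simp: indices_def)

lemma h_measurable: "h \<in> borel_measurable (PiM {1..m} (\<lambda>_. S))"
  using kernel by (simp add: symmetric_kernel_def)

lemma kernel_at_measurable [measurable]: "i \<in> indices \<Longrightarrow> kernel_at i \<in> borel_measurable M"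
  unfolding kernel_at_def[abs_def] indices_def
  by (rule measurable_compose[OF selection_measurable h_measurable]) auto

lemma kernel_at_square_integrable: "i \<in> indices \<Longrightarrow> integrable M (\<lambda>\<omega>. (kernel_at i \<omega>)\<^sup>2)"
  using integrable_selection[of i "{1..m}" "\<lambda>x. (h x)\<^sup>2"] square h_measurable
  by (auto simp: kernel_at_def indices_def)

lemma kernel_at_mult_integrable:
  assumes "i \<in> indices" "i' \<in> indices"
  shows "integrable M (\<lambda>\<omega>. kernel_at i \<omega> * kernel_at i' \<omega>)"
proof (rule Bochner_Integration.integrable_bound)
  show "integrable M (\<lambda>\<omega>. (kernel_at i \<omega>)\<^sup>2 + (kernel_at i' \<omega>)\<^sup>2)"
    using assms kernel_at_square_integrable by auto
  have "\<bar>a * b\<bar> \<le> a\<^sup>2 + b\<^sup>2" for a b :: real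
    using sum_squares_bound[of "\<bar>a\<bar>" "\<bar>b\<bar>"] by (auto simp: abs_mult intro: order_trans[rotated])
  thus "AE \<omega> in M. norm (kernel_at i \<omega> * kernel_at i' \<omega>) \<le> norm ((kernel_at i \<omega>)\<^sup>2 + (kernel_at i' \<omega>)\<^sup>2)"
    by auto
qed (use assms in measurable)

text \<open>
  Two enumerations of the same set differ by a permutation, which the symmetric kernel ignores.
\<close>

lemma kernel_at_cong_image:
  assumes "i \<in> indices" "i' \<in> indices" "i ` {1..m} = i' ` {1..m}" "\<omega> \<in> space M"
  shows "kernel_at i \<omega> = kernel_at i' \<omega>"
proof -
  define \<pi> where "\<pi> = (\<lambda>j. if j \<in> {1..m} then inv_into {1..m} i (i' j) else j)"
  have bi: "bij_betw i {1..m} (i ` {1..m})" and bi': "bij_betw i' {1..m} (i ` {1..m})"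
    using assms by (auto simp: indices_def bij_betw_def)
  have "bij_betw (inv_into {1..m} i \<circ> i') {1..m} {1..m}"
    using bi' bij_betw_inv_into[OF bi] by (rule bij_betw_trans)
  hence "bij_betw \<pi> {1..m} {1..m}"
    by (subst bij_betw_cong[of _ _ "inv_into {1..m} i \<circ> i'"]) (auto simp: \<pi>_def)
  hence \<pi>: "\<pi> permutes {1..m}"
    by (rule bij_imp_permutes) (auto simp: \<pi>_def)
  have i\<pi>: "i (\<pi> j) = i' j" if "j \<in> {1..m}" for j
    using that assms(3) by (auto simp: \<pi>_def f_inv_into_f)
  let ?x = "\<lambda>j\<in>{1..m}. X (i j) \<omega>"
  have x: "?x \<in> space (PiM {1..m} (\<lambda>_. S))"
    using measurable_space[OF selection_measurable assms(4)] assms(1) by (auto simp: indices_def)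
  have "h (\<lambda>j\<in>{1..m}. ?x (\<pi> j)) = h ?x"
    using kernel \<pi> x by (auto simp only: symmetric_kernel_def)
  moreover have "(\<lambda>j\<in>{1..m}. ?x (\<pi> j)) = (\<lambda>j\<in>{1..m}. X (i' j) \<omega>)"
    using i\<pi> permutes_in_image[OF \<pi>] by (intro restrict_ext) (simp del: atLeastAtMost_iff)
  ultimately show ?thesis by (simp add: kernel_at_def)
qed

lemma expectation_transport:
  assumes "i \<in> indices" "i' \<in> indices"
    and \<sigma>: "inj_on \<sigma> (i ` {1..m} \<union> i' ` {1..m})" "\<sigma> \<in> (i ` {1..m} \<union> i' ` {1..m}) \<rightarrow> {1..}"
  shows "expectation (\<lambda>\<omega>. kernel_at (\<sigma> \<circ> i) \<omega> * kernel_at (\<sigma> \<circ> i') \<omega>) = expectation (\<lambda>\<omega>. kernel_at i \<omega> * kernel_at i' \<omega>)"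
proof -
  let ?I = "i ` {1..m} \<union> i' ` {1..m}"
  let ?g = "\<lambda>y. h (\<lambda>j\<in>{1..m}. y (i j)) * h (\<lambda>j\<in>{1..m}. y (i' j))"
  have I: "?I \<subseteq> {1..}" using assms by (auto simp: indices_def)
  have g: "?g \<in> borel_measurable (PiM ?I (\<lambda>_. S))"
    by (intro borel_measurable_times measurable_compose[OF _ h_measurable] measurable_restrict
          measurable_component_singleton) auto
  have eq: "(\<lambda>\<omega>. ?g (\<lambda>a\<in>?I. X (\<tau> a) \<omega>)) = (\<lambda>\<omega>. kernel_at (\<tau> \<circ> i) \<omega> * kernel_at (\<tau> \<circ> i') \<omega>)" for \<tau>
    by (auto simp: kernel_at_def fun_eq_iff intro!: arg_cong2[of _ _ _ _ "(*)"] arg_cong[of _ _ h] restrict_ext)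
  show ?thesis
    using expectation_selection[OF \<sigma> I g] unfolding eq eq[of "\<lambda>a. a"] by (simp add: comp_def)
qed

text \<open>
  The mixed second moment of two evaluations of the kernel sees the two index tuples only through the
  size of their overlap.  A relabelling of the indices carries the two index sets to any other pair of
  the same relative position, exchangeability says that relabelling is harmless, and symmetry says
  that only the index sets matter.
\<close>

lemma expectation_overlap:
  assumes "i \<in> indices" "i' \<in> indices" "j \<in> indices" "j' \<in> indices"
    and "card (i ` {1..m} \<inter> i' ` {1..m}) = card (j ` {1..m} \<inter> j' ` {1..m})"
  shows "expectation (\<lambda>\<omega>. kernel_at i \<omega> * kernel_at i' \<omega>) = expectation (\<lambda>\<omega>. kernel_at j \<omega> * kernel_at j' \<omega>)"
proof -
  have card: "card (a ` {1..m}) = m" if "a \<in> indices" for a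
    using that by (simp add: indices_def card_image)
  obtain \<sigma> where \<sigma>: "inj_on \<sigma> (i ` {1..m} \<union> i' ` {1..m})"
      and im: "\<sigma> ` i ` {1..m} = j ` {1..m}" "\<sigma> ` i' ` {1..m} = j' ` {1..m}"
    using overlap_transport[of "i ` {1..m}" "i' ` {1..m}" "j ` {1..m}" "j' ` {1..m}"] card assms
    by auto
  have "\<sigma> ` (i ` {1..m} \<union> i' ` {1..m}) \<subseteq> {1..}"
    unfolding image_Un im using assms by (auto simp: indices_def)
  hence \<sigma>': "\<sigma> \<in> (i ` {1..m} \<union> i' ` {1..m}) \<rightarrow> {1..}" by blast
  have "inj_on (\<sigma> \<circ> i) {1..m}" "inj_on (\<sigma> \<circ> i') {1..m}"
    using assms \<sigma> by (auto simp: indices_def intro!: comp_inj_on intro: inj_on_subset)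
  hence ind: "\<sigma> \<circ> i \<in> indices" "\<sigma> \<circ> i' \<in> indices"
    using \<sigma>' by (auto simp: indices_def)
  have "expectation (\<lambda>\<omega>. kernel_at i \<omega> * kernel_at i' \<omega>) = expectation (\<lambda>\<omega>. kernel_at (\<sigma> \<circ> i) \<omega> * kernel_at (\<sigma> \<circ> i') \<omega>)"
    using expectation_transport[OF assms(1,2) \<sigma> \<sigma>'] by simp
  also have "\<dots> = expectation (\<lambda>\<omega>. kernel_at j \<omega> * kernel_at j' \<omega>)"
  proof (rule Bochner_Integration.integral_cong[OF refl])
    fix \<omega> assume "\<omega> \<in> space M"
    thus "kernel_at (\<sigma> \<circ> i) \<omega> * kernel_at (\<sigma> \<circ> i') \<omega> = kernel_at j \<omega> * kernel_at j' \<omega>"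
      using kernel_at_cong_image[OF ind(1) assms(3)] kernel_at_cong_image[OF ind(2) assms(4)] im
      by (simp add: image_comp)
  qed
  finally show ?thesis .
qed

text \<open>
  For fixed \<open>q\<close> and varying \<open>b\<close> these tuples have the common entries \<open>1, \<dots>, q\<close> and are pairwise disjoint
  otherwise.  Two of them serve as the reference pair with overlap \<open>q\<close>, and a long family of them
  yields the sign of the moment below.
\<close>

definition star_tuple :: "nat \<Rightarrow> nat \<Rightarrow> nat \<Rightarrow> nat" where
  "star_tuple q b j = (if j \<le> q then j else j + b * m)"

definition overlap_moment :: "nat \<Rightarrow> real" where
  "overlap_moment q = expectation (\<lambda>\<omega>. kernel_at (star_tuple q 0) \<omega> * kernel_at (star_tuple q 1) \<omega>)"

lemma star_tuple_indices: "star_tuple q b \<in> indices"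
  by (auto simp: indices_def star_tuple_def inj_on_def split: if_splits)

lemma star_tuple_overlap:
  assumes "q \<le> m" "b \<noteq> b'"
  shows "card (star_tuple q b ` {1..m} \<inter> star_tuple q b' ` {1..m}) = q"
proof -
  have "star_tuple q b ` {1..m} \<inter> star_tuple q b' ` {1..m} = {1..q}"
  proof (intro equalityI subsetI)
    fix x assume "x \<in> star_tuple q b ` {1..m} \<inter> star_tuple q b' ` {1..m}"
    then obtain j j' where j: "j \<in> {1..m}" "x = star_tuple q b j"
      and j': "j' \<in> {1..m}" "x = star_tuple q b' j'" by auto
    show "x \<in> {1..q}"
    proof (cases "j \<le> q \<or> j' \<le> q")
      case True
      thus ?thesis using j j' by (auto simp: star_tuple_def split: if_splits)
    next
      case False
      \<comment> \<open>Beyond \<open>q\<close> the entries with block number \<open>b\<close> lie in \<open>{b * m + 1..b * m + m}\<close>, so division recovers \<open>b\<close>.\<close>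
      hence eq: "(j - 1) + b * m = (j' - 1) + b' * m"
        using j j' by (auto simp: star_tuple_def)
      have div: "(a + c * m) div m = c" if "a < m" for a c
        using that by simp
      have "((j - 1) + b * m) div m = b"
        by (rule div) (use j(1) in auto)
      moreover have "((j' - 1) + b' * m) div m = b'"
        by (rule div) (use j'(1) in auto)
      ultimately have "b = b'" using eq by simp
      with assms(2) show ?thesis by simp
    qed
  next
    fix x assume "x \<in> {1..q}"
    thus "x \<in> star_tuple q b ` {1..m} \<inter> star_tuple q b' ` {1..m}"
      using assms(1) by (auto simp: star_tuple_def image_iff intro!: bexI[of _ x])
  qed
  thus ?thesis by simp
qed

lemma expectation_overlap_moment:
  assumes "i \<in> indices" "i' \<in> indices"
  shows "expectation (\<lambda>\<omega>. kernel_at i \<omega> * kernel_at i' \<omega>) = overlap_moment (card (i ` {1..m} \<inter> i' ` {1..m}))"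
proof -
  let ?q = "card (i ` {1..m} \<inter> i' ` {1..m})"
  have "card (i ` {1..m} \<inter> i' ` {1..m}) \<le> card (i ` {1..m})" by (intro card_mono) auto
  also have "\<dots> = m" using assms by (simp add: indices_def card_image)
  finally have "card (star_tuple ?q 0 ` {1..m} \<inter> star_tuple ?q 1 ` {1..m}) = ?q"
    by (rule star_tuple_overlap) simp
  from expectation_overlap[OF assms star_tuple_indices star_tuple_indices this[symmetric]]
  show ?thesis unfolding overlap_moment_def .
qed

text \<open>
  The moment is the second moment of the conditional expectation of the kernel given \<open>q\<close> of its
  arguments, hence nonnegative.  The proof avoids conditioning: the square of the sum of \<open>B + 1\<close>
  evaluations with pairwise overlap \<open>q\<close> has the nonnegative expectation
  \<open>(B + 1) * (overlap_moment m + B * overlap_moment q)\<close> for every \<open>B\<close>, which for large \<open>B\<close> excludes a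
  negative \<open>overlap_moment q\<close>.
\<close>

lemma overlap_moment_nonneg:
  assumes "q \<le> m"
  shows "overlap_moment q \<ge> 0"
proof -
  have bound: "0 \<le> overlap_moment m + real B * overlap_moment q" for B :: nat
  proof -
    have "0 \<le> expectation (\<lambda>\<omega>. (\<Sum>b\<le>B. kernel_at (star_tuple q b) \<omega>)\<^sup>2)" by simp
    also have "\<dots> = expectation (\<lambda>\<omega>. \<Sum>b\<le>B. \<Sum>b'\<le>B. kernel_at (star_tuple q b) \<omega> * kernel_at (star_tuple q b') \<omega>)"
      by (simp add: power2_eq_square sum_product)
    also have "\<dots> = (\<Sum>b\<le>B. \<Sum>b'\<le>B. expectation (\<lambda>\<omega>. kernel_at (star_tuple q b) \<omega> * kernel_at (star_tuple q b') \<omega>))"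
      by (simp add: Bochner_Integration.integral_sum kernel_at_mult_integrable star_tuple_indices)
    also have "\<dots> = (\<Sum>b\<le>B. \<Sum>b'\<le>B. overlap_moment (if b' = b then m else q))"
    proof (intro sum.cong refl)
      fix b b'
      have "card (star_tuple q b ` {1..m}) = m"
        using star_tuple_indices[of q b] by (simp add: indices_def card_image)
      thus "expectation (\<lambda>\<omega>. kernel_at (star_tuple q b) \<omega> * kernel_at (star_tuple q b') \<omega>)
              = overlap_moment (if b' = b then m else q)"
        using star_tuple_overlap[OF assms, of b b']
        by (auto simp: expectation_overlap_moment star_tuple_indices)
    qed
    also have "\<dots> = (\<Sum>b\<le>B. overlap_moment m + real B * overlap_moment q)"
    proof (intro sum.cong refl)
      fix b assume "b \<in> {..B}"
      hence "(\<Sum>b'\<le>B. overlap_moment (if b' = b then m else q))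
           = overlap_moment m + (\<Sum>b'\<in>{..B} - {b}. overlap_moment q)"
        by (subst sum.remove[of _ b]) (auto intro!: sum.cong)
      thus "(\<Sum>b'\<le>B. overlap_moment (if b' = b then m else q)) = overlap_moment m + real B * overlap_moment q"
        using \<open>b \<in> {..B}\<close> by simp
    qed
    also have "\<dots> = real (Suc B) * (overlap_moment m + real B * overlap_moment q)" by simp
    finally show ?thesis by (simp only: zero_le_mult_iff) linarith
  qed
  show ?thesis
  proof (rule ccontr)
    assume "\<not> ?thesis"
    then obtain B :: nat where "overlap_moment m < real B * - overlap_moment q"
      using reals_Archimedean3[of "- overlap_moment q"] by auto
    with bound[of B] show False by simp
  qed
qed

definition W :: "nat \<Rightarrow> 'w \<Rightarrow> real" where
  "W k \<omega> = U_sum m h (\<lambda>i. X i \<omega>) k"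

lemma W_eq: "W k \<omega> = (\<Sum>i\<in>distinct_tuples m k. kernel_at i \<omega>)"
  by (simp add: W_def U_sum_def kernel_at_def)

lemma W_mult_integrable: "integrable M (\<lambda>\<omega>. W k \<omega> * W l \<omega>)"
  unfolding W_eq sum_product using distinct_tuples_indices
  by (intro Bochner_Integration.integrable_sum kernel_at_mult_integrable) blast+

lemma W_diff_square_integrable: "integrable M (\<lambda>\<omega>. (W k \<omega> - W l \<omega>)\<^sup>2)"
  unfolding power2_eq_square by (simp add: algebra_simps W_mult_integrable)

text \<open>
  Expand the product into pairs of tuples and group them by overlap.  As the smaller index range is
  contained in the larger one, the number of partners of a tuple with a given overlap does not depend
  on the tuple.
\<close>

lemma W_mult_expectation_le:
  assumes "k \<le> l"
  shows "expectation (\<lambda>\<omega>. W k \<omega> * W l \<omega>) =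
    (\<Sum>q\<le>m. (fact m)\<^sup>2 * real (m choose q) * overlap_moment q
        * (real (k choose m) * real ((l - m) choose (m - q))))"
proof -
  let ?c = "\<lambda>i i'. card (i ` {1..m} \<inter> i' ` {1..m})"
  have ind: "i \<in> indices" if "i \<in> distinct_tuples m k" for i k
    using that distinct_tuples_indices by blast
  have "expectation (\<lambda>\<omega>. W k \<omega> * W l \<omega>)
      = (\<Sum>i\<in>distinct_tuples m k. \<Sum>i'\<in>distinct_tuples m l. expectation (\<lambda>\<omega>. kernel_at i \<omega> * kernel_at i' \<omega>))"
    by (simp add: W_eq sum_product Bochner_Integration.integral_sum kernel_at_mult_integrable ind)
  also have "\<dots> = (\<Sum>i\<in>distinct_tuples m k. \<Sum>i'\<in>distinct_tuples m l. overlap_moment (?c i i'))"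
    by (intro sum.cong refl expectation_overlap_moment) (auto intro: ind)
  also have "\<dots> = (\<Sum>i\<in>distinct_tuples m k. \<Sum>q\<le>m. overlap_moment q
                    * (fact m * (real (m choose q) * real ((l - m) choose (m - q)))))"
  proof (intro sum.cong refl)
    fix i assume i: "i \<in> distinct_tuples m k"
    have "?c i i' \<le> m" for i'
      using card_mono[of "i ` {1..m}" "i ` {1..m} \<inter> i' ` {1..m}"] distinct_tuplesD(3)[OF i] by simp
    hence "(\<Sum>i'\<in>distinct_tuples m l. overlap_moment (?c i i'))
        = (\<Sum>q\<le>m. \<Sum>i' | i' \<in> distinct_tuples m l \<and> ?c i i' = q. overlap_moment (?c i i'))"
      by (intro sum.group[symmetric]) auto
    also have "\<dots> = (\<Sum>q\<le>m. overlap_moment q * (fact m * (real (m choose q) * real ((l - m) choose (m - q)))))"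
      using card_distinct_tuples_overlap[OF i assms] by (intro sum.cong refl) simp
    finally show "(\<Sum>i'\<in>distinct_tuples m l. overlap_moment (?c i i')) = \<dots>" .
  qed
  also have "\<dots> = real (card (distinct_tuples m k)) * (\<Sum>q\<le>m. overlap_moment q
                    * (fact m * (real (m choose q) * real ((l - m) choose (m - q)))))"
    by simp
  also have "\<dots> = (\<Sum>q\<le>m. (fact m)\<^sup>2 * real (m choose q) * overlap_moment q
        * (real (k choose m) * real ((l - m) choose (m - q))))"
    by (simp add: card_distinct_tuples sum_distrib_left power2_eq_square mult_ac)
  finally show ?thesis .
qed

end

section \<open>Averaging over an independent random index\<close>

lemma preimages_compose_subset:
  assumes "Y \<in> measurable M A" "f \<in> measurable A B"
  shows "{(\<lambda>\<omega>. f (Y \<omega>)) -` b \<inter> space M |b. b \<in> sets B} \<subseteq> {Y -` a \<inter> space M |a. a \<in> sets A}"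
proof
  fix c assume "c \<in> {(\<lambda>\<omega>. f (Y \<omega>)) -` b \<inter> space M |b. b \<in> sets B}"
  then obtain b where b: "c = (\<lambda>\<omega>. f (Y \<omega>)) -` b \<inter> space M" "b \<in> sets B"
    by (elim CollectE exE conjE)
  have "c = Y -` (f -` b \<inter> space A) \<inter> space M"
    using b(1) measurable_space[OF assms(1)] by auto
  thus "c \<in> {Y -` a \<inter> space M |a. a \<in> sets A}"
    using measurable_sets[OF assms(2) b(2)] by (intro CollectI exI conjI)
qed

text \<open>
  Fubini for an independent random index: decompose the expectation over the values of the index, and
  use independence on each piece.  Both sides are integrals of nonnegative functions, so the
  computation is done with the nonnegative integral and if that is infinite, both sides are \<open>0\<close> by convention.
\<close>

lemma (in prob_space) expectation_random_index:
  fixes g :: "nat \<Rightarrow> 'b \<Rightarrow> real"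
  assumes indep: "indep_rvs M (count_space UNIV) N B Z"
    and p: "distr M (count_space UNIV) N = measure_pmf p"
    and g: "\<And>k. g k \<in> borel_measurable B" "\<And>k z. 0 \<le> g k z"
    and int: "\<And>k. integrable M (\<lambda>\<omega>. g k (Z \<omega>))"
  shows "expectation (\<lambda>\<omega>. g (N \<omega>) (Z \<omega>)) = measure_pmf.expectation p (\<lambda>k. expectation (\<lambda>\<omega>. g k (Z \<omega>)))"
proof -
  have N[measurable]: "N \<in> measurable M (count_space UNIV)" and Z[measurable]: "Z \<in> measurable M B"
    using indep unfolding indep_rvs_def by simp_all
  have gZ[measurable]: "random_variable borel (\<lambda>\<omega>. g k (Z \<omega>))" for k
    by (rule measurable_compose[OF Z g(1)])
  have iN[measurable]: "random_variable borel (\<lambda>\<omega>. indicator {k} (N \<omega>) :: real)" for k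
    by (rule measurable_compose[OF N]) simp
  let ?E = "\<lambda>k. expectation (\<lambda>\<omega>. g k (Z \<omega>))"
  have one: "(\<integral>\<^sup>+\<omega>. ennreal (indicator {k} (N \<omega>) * g k (Z \<omega>)) \<partial>M) = ennreal (pmf p k) * ennreal (?E k)" for k
  proof -
    have preimage: "sigma_sets (space M) {f -` C \<inter> space M |C. C \<in> sets borel}
        \<subseteq> {Y -` a \<inter> space M |a. a \<in> sets A}"
      if Y: "Y \<in> measurable M A" and \<phi>: "\<phi> \<in> borel_measurable A" and f: "f = (\<lambda>\<omega>. \<phi> (Y \<omega>))"
      for f \<phi> :: "_ \<Rightarrow> real" and Y :: "'a \<Rightarrow> 'c" and A
    proof -
      have eq: "sigma_sets (space M) {f -` C \<inter> space M |C. C \<in> sets borel} = {f -` C \<inter> space M |C. C \<in> sets borel}"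
        using sets_vimage_algebra[of "space M" f borel] sets_vimage_algebra2[of f "space M" borel] by simp
      show ?thesis
        unfolding eq unfolding f by (rule preimages_compose_subset[OF Y \<phi>])
    qed
    have "indep_var borel (\<lambda>\<omega>. indicator {k} (N \<omega>)) borel (\<lambda>\<omega>. g k (Z \<omega>))"
      unfolding indep_var_eq
    proof (intro conjI)
      show "random_variable borel (\<lambda>\<omega>. indicator {k} (N \<omega>) :: real)"
        by (rule iN)
      show "random_variable borel (\<lambda>\<omega>. g k (Z \<omega>))"
        by (rule gZ)
      have "indep_set {N -` a \<inter> space M |a. a \<in> sets (count_space UNIV)} {Z -` b \<inter> space M |b. b \<in> sets B}"
        using indep by (simp add: indep_rvs_def)
      thus "indep_set (sigma_sets (space M) {(\<lambda>\<omega>. indicator {k} (N \<omega>) :: real) -` C \<inter> space M |C. C \<in> sets borel})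
         (sigma_sets (space M) {(\<lambda>\<omega>. g k (Z \<omega>)) -` C \<inter> space M |C. C \<in> sets borel})"
        using preimage[OF N, of "indicator {k}", OF _ refl] preimage[OF Z g(1) refl]
        unfolding indep_sets2_eq by (meson borel_measurable_count_space subset_iff)
    qed
    moreover have ind: "integrable M (\<lambda>\<omega>. indicator {k} (N \<omega>) :: real)"
      by (rule integrable_const_bound[of _ 1]) (auto intro: measurable_compose[OF N])
    ultimately have *: "expectation (\<lambda>\<omega>. indicator {k} (N \<omega>) * g k (Z \<omega>)) = expectation (\<lambda>\<omega>. indicator {k} (N \<omega>)) * ?E k"
      "integrable M (\<lambda>\<omega>. indicator {k} (N \<omega>) * g k (Z \<omega>))"
      using int by (auto intro: indep_var_lebesgue_integral indep_var_integrable)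
    have "expectation (\<lambda>\<omega>. indicator {k} (N \<omega>)) = (\<integral>x. (indicator {k} x :: real) \<partial>distr M (count_space UNIV) N)"
      by (rule integral_distr[OF N, symmetric]) simp
    also have "\<dots> = pmf p k" unfolding p by (simp add: measure_pmf_single)
    finally show ?thesis
      using * g(2) by (subst nn_integral_eq_integral) (auto simp: ennreal_mult')
  qed
  have "(\<integral>\<^sup>+\<omega>. ennreal (g (N \<omega>) (Z \<omega>)) \<partial>M) = (\<integral>\<^sup>+\<omega>. (\<Sum>k. ennreal (indicator {k} (N \<omega>) * g k (Z \<omega>))) \<partial>M)"
  proof (rule nn_integral_cong)
    fix \<omega>
    have "(\<Sum>k. ennreal (indicator {k} (N \<omega>) * g k (Z \<omega>)))
        = (\<Sum>k\<in>{N \<omega>}. ennreal (indicator {k} (N \<omega>) * g k (Z \<omega>)))"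
      by (rule suminf_finite) auto
    thus "ennreal (g (N \<omega>) (Z \<omega>)) = (\<Sum>k. ennreal (indicator {k} (N \<omega>) * g k (Z \<omega>)))" by simp
  qed
  also have "\<dots> = (\<Sum>k. ennreal (pmf p k) * ennreal (?E k))"
    by (subst nn_integral_suminf) (measurable, simp only: one)
  also have "\<dots> = (\<integral>\<^sup>+k. ennreal (?E k) \<partial>measure_pmf p)"
    by (simp add: nn_integral_measure_pmf nn_integral_count_space_nat)
  finally have eq: "(\<integral>\<^sup>+\<omega>. ennreal (g (N \<omega>) (Z \<omega>)) \<partial>M) = \<dots>" .
  have "(\<lambda>\<omega>. g (N \<omega>) (Z \<omega>)) \<in> borel_measurable M"
    using gZ N by (rule measurable_compose_countable)
  hence "expectation (\<lambda>\<omega>. g (N \<omega>) (Z \<omega>)) = enn2real (\<integral>\<^sup>+\<omega>. ennreal (g (N \<omega>) (Z \<omega>)) \<partial>M)"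
    using g(2) by (intro integral_eq_nn_integral) auto
  also have "\<dots> = measure_pmf.expectation p ?E"
    unfolding eq using g(2) by (intro integral_eq_nn_integral[symmetric]) auto
  finally show ?thesis .
qed

lemma (in prob_space) indep_rvs_compose:
  assumes "indep_rvs M A Y B Z" "f \<in> measurable A A'"
  shows "indep_rvs M A' (\<lambda>\<omega>. f (Y \<omega>)) B Z"
proof -
  have Y: "Y \<in> measurable M A" using assms by (simp add: indep_rvs_def)
  note preimages_compose_subset[OF Y assms(2)]
  moreover have "(\<lambda>\<omega>. f (Y \<omega>)) \<in> measurable M A'"
    using Y assms(2) by (rule measurable_compose)
  ultimately show ?thesis
    using assms(1) unfolding indep_rvs_def indep_sets2_eq by (meson subset_iff)
qed

lemma U_sum_cong:
  assumes "\<And>a. 1 \<le> a \<Longrightarrow> x a = y a"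
  shows "U_sum m h x k = U_sum m h y k"
proof -
  have "(\<lambda>j\<in>{1..m}. x (i j)) = (\<lambda>j\<in>{1..m}. y (i j))" if "i \<in> distinct_tuples m k" for i
    using distinct_tuplesD(4)[OF that] assms by (intro restrict_ext) (auto simp: Pi_iff)
  thus ?thesis by (simp add: U_sum_def)
qed

lemma U_sum_measurable:
  assumes "symmetric_kernel S m h"
  shows "(\<lambda>x. U_sum m h x k) \<in> borel_measurable (PiM {1..} (\<lambda>_. S))"
  unfolding U_sum_def
proof (intro borel_measurable_sum)
  fix i assume "i \<in> distinct_tuples m k"
  hence "i j \<in> {1..}" if "j \<in> {1..m}" for j
    using distinct_tuplesD(4)[of i m k] that by (auto simp: Pi_iff)
  hence "(\<lambda>x. \<lambda>j\<in>{1..m}. x (i j)) \<in> measurable (PiM {1..} (\<lambda>_. S)) (PiM {1..m} (\<lambda>_. S))"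
    by (intro measurable_restrict measurable_component_singleton)
  moreover have "h \<in> borel_measurable (PiM {1..m} (\<lambda>_. S))"
    using assms by (simp add: symmetric_kernel_def)
  ultimately show "(\<lambda>x. h (\<lambda>j\<in>{1..m}. x (i j))) \<in> borel_measurable (PiM {1..} (\<lambda>_. S))"
    by (rule measurable_compose)
qed

section \<open>Moments of the Poisson distribution\<close>

text \<open>
  Binomial coefficients of a Poisson variable, that is, its factorial moments up to a constant, have a
  closed form; the exponential series is merely shifted by \<open>r\<close>.
\<close>

lemma
  assumes "0 < rate"
  shows expectation_poisson_choose:
      "measure_pmf.expectation (poisson_pmf rate) (\<lambda>k. real (k choose r)) = rate ^ r / fact r" (is ?E)
    and integrable_poisson_choose:
      "integrable (poisson_pmf rate) (\<lambda>k. real (k choose r))" (is ?I)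
proof -
  let ?f = "\<lambda>k. pmf (poisson_pmf rate) k * real (k choose r)"
  have shift: "?f (k + r) = (rate ^ r / fact r * exp (-rate)) * (rate ^ k /\<^sub>R fact k)" for k
    using assms by (simp add: binomial_fact power_add field_simps)
  have "(\<lambda>k. ?f (k + r)) sums ((rate ^ r / fact r * exp (-rate)) * exp rate)"
    unfolding shift by (intro sums_mult exp_converges)
  moreover have "(rate ^ r / fact r * exp (-rate)) * exp rate = rate ^ r / fact r"
    by (simp add: exp_minus)
  moreover have "?f k = 0" if "k < r" for k using that by simp
  ultimately have sums: "?f sums (rate ^ r / fact r)"
    using sums_zero_iff_shift[of r ?f "rate ^ r / fact r"] by (simp only: simp_thms)
  have "0 \<le> ?f k" for k by simp
  hence "(\<Sum>k. ennreal (?f k)) = ennreal (rate ^ r / fact r)"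
    using suminf_ennreal2[OF _ sums_summable[OF sums]] sums_unique[OF sums] by (simp only:)
  hence eq: "(\<integral>\<^sup>+k. ennreal (real (k choose r)) \<partial>poisson_pmf rate) = ennreal (rate ^ r / fact r)"
    by (simp add: nn_integral_measure_pmf nn_integral_count_space_nat ennreal_mult'[symmetric]
        del: pmf_poisson)
  show ?I
    by (rule integrableI_nn_integral_finite[OF _ _ eq]) (use assms in auto)
  show ?E
    using assms by (subst integral_eq_nn_integral) (auto simp: eq)
qed

text \<open>
  The variance is \<open>rate\<close>, so the mean absolute deviation is at most \<open>sqrt rate\<close>.  Instead of the
  Cauchy-Schwarz inequality, the pointwise bound \<open>2 * \<bar>x\<bar> \<le> sqrt rate + x\<^sup>2 / sqrt rate\<close> is integrated,
  which also gives integrability.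
\<close>

lemma
  assumes "0 < rate"
  shows expectation_poisson_deviation:
      "measure_pmf.expectation (poisson_pmf rate) (\<lambda>k. \<bar>real k - rate\<bar>) \<le> sqrt rate" (is ?E)
    and integrable_poisson_deviation:
      "integrable (poisson_pmf rate) (\<lambda>k. \<bar>real k - rate\<bar>)" (is ?I)
proof -
  let ?P = "measure_pmf (poisson_pmf rate)"
  have sq: "(real k - rate)\<^sup>2 = 2 * real (k choose 2) + (1 - 2 * rate) * real (k choose 1) + rate\<^sup>2" for k
  proof -
    have "2 * real (k choose 2) = real k * (real k - 1)"
      by (induction k) (simp_all add: numeral_2_eq_2 algebra_simps)
    thus ?thesis by (simp add: power2_eq_square algebra_simps)
  qed
  have int: "integrable ?P (\<lambda>k. (real k - rate)\<^sup>2)"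
    unfolding sq by (intro Bochner_Integration.integrable_add integrable_mult_right
        integrable_poisson_choose assms) simp
  have E: "measure_pmf.expectation (poisson_pmf rate) (\<lambda>k. (real k - rate)\<^sup>2) = rate"
  proof -
    have "measure_pmf.expectation (poisson_pmf rate) (\<lambda>k. (real k - rate)\<^sup>2)
        = 2 * measure_pmf.expectation (poisson_pmf rate) (\<lambda>k. real (k choose 2))
          + (1 - 2 * rate) * measure_pmf.expectation (poisson_pmf rate) (\<lambda>k. real (k choose 1)) + rate\<^sup>2"
      unfolding sq using integrable_poisson_choose[OF assms, of 2] integrable_poisson_choose[OF assms, of 1]
      by simp
    also have "\<dots> = rate"
      unfolding expectation_poisson_choose[OF assms] by (simp add: power2_eq_square algebra_simps)
    finally show ?thesis .
  qed
  have le: "\<bar>real k - rate\<bar> \<le> (sqrt rate + (real k - rate)\<^sup>2 / sqrt rate) / 2" for k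
  proof -
    have "2 * sqrt rate * \<bar>real k - rate\<bar> \<le> (sqrt rate)\<^sup>2 + \<bar>real k - rate\<bar>\<^sup>2"
      by (rule sum_squares_bound)
    thus ?thesis using assms by (simp add: field_simps power2_eq_square)
  qed
  have int': "integrable ?P (\<lambda>k. (sqrt rate + (real k - rate)\<^sup>2 / sqrt rate) / 2)"
    using int by simp
  show I: ?I
  proof (rule Bochner_Integration.integrable_bound[OF int'])
    have "norm \<bar>real k - rate\<bar> \<le> norm ((sqrt rate + (real k - rate)\<^sup>2 / sqrt rate) / 2)" for k
      unfolding real_norm_def abs_idempotent by (rule order_trans[OF le abs_ge_self])
    thus "AE k in ?P. norm \<bar>real k - rate\<bar> \<le> norm ((sqrt rate + (real k - rate)\<^sup>2 / sqrt rate) / 2)"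
      by (rule AE_I2)
  qed simp
  have "measure_pmf.expectation (poisson_pmf rate) (\<lambda>k. \<bar>real k - rate\<bar>)
      \<le> measure_pmf.expectation (poisson_pmf rate) (\<lambda>k. (sqrt rate + (real k - rate)\<^sup>2 / sqrt rate) / 2)"
    by (rule integral_mono[OF I int']) (rule le)
  also have "\<dots> = (sqrt rate + rate / sqrt rate) / 2"
    using int E by simp
  also have "\<dots> = sqrt rate" using assms by (simp add: real_div_sqrt)
  finally show ?E .
qed

section \<open>Asymptotics of the number of overlapping pairs\<close>

text \<open>
  Up to a factor that depends only on \<open>m\<close> and \<open>q\<close>, this is the number of pairs of tuples with overlap
  \<open>q\<close>, one with entries up to \<open>k\<close> and one with entries up to \<open>l\<close>: choose the entries of the tuple with
  the smaller range, then the \<open>m - q\<close> further entries of the other tuple.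
\<close>

definition overlap_count :: "nat \<Rightarrow> nat \<Rightarrow> nat \<Rightarrow> nat \<Rightarrow> real" where
  "overlap_count m q k l = real (min k l choose m) * real ((max k l - m) choose (m - q))"

text \<open>
  The leading term of the above for \<open>k\<close> and \<open>l\<close> both close to \<open>x\<close>: of the \<open>2 * m\<close> entries, \<open>2 * m - q\<close> are
  free.
\<close>

definition overlap_limit :: "nat \<Rightarrow> nat \<Rightarrow> real \<Rightarrow> real" where
  "overlap_limit m q x = x ^ (2 * m - q) / (fact m * fact (m - q))"

text \<open>
  On the diagonal the product of binomial coefficients is a single one up to a constant.  This is what
  makes its Poisson expectation exactly computable.
\<close>

lemma overlap_count_diagonal:
  assumes "q \<le> m"
  shows "overlap_count m q k k = fact (2 * m - q) / (fact m * fact (m - q)) * real (k choose (2 * m - q))"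
proof (cases "2 * m - q \<le> k")
  case True
  have "(k choose m) * ((k - m) choose (m - q)) = (k choose (2 * m - q)) * ((2 * m - q) choose m)"
    using choose_mult[of m "2 * m - q" k] assms True by (simp add: mult_2)
  moreover have "real ((2 * m - q) choose m) = fact (2 * m - q) / (fact m * fact (m - q))"
    using binomial_fact[of m "2 * m - q", where 'a = real] assms by (simp add: mult_2)
  ultimately show ?thesis
    by (simp add: overlap_count_def flip: of_nat_mult) (simp add: mult.commute)
next
  case False
  hence "k < m \<or> k - m < m - q" by linarith
  with False show ?thesis by (auto simp: overlap_count_def binomial_eq_0)
qed

lemma
  assumes "0 < rate" "q \<le> m"
  shows expectation_overlap_count_diagonal:
      "measure_pmf.expectation (poisson_pmf rate) (\<lambda>k. overlap_count m q k k) = overlap_limit m q rate"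
    and integrable_overlap_count_diagonal:
      "integrable (poisson_pmf rate) (\<lambda>k. overlap_count m q k k)"
  using assms by (simp_all add: overlap_count_diagonal overlap_limit_def expectation_poisson_choose
      integrable_poisson_choose)

lemma overlap_count_diagonal_le:
  assumes "q \<le> m"
  shows "overlap_count m q n n \<le> overlap_limit m q (real n)"
proof -
  have "fact (2 * m - q) * real (n choose (2 * m - q)) \<le> real n ^ (2 * m - q)"
    using of_nat_mono[OF binomial_fact_pow[of n "2 * m - q"], where 'a = real]
    by (simp add: mult.commute)
  thus ?thesis
    by (simp add: overlap_count_diagonal[OF assms] overlap_limit_def divide_right_mono)
qed

lemma power_le_falling_factorial:
  fixes b :: nat
  assumes "b \<le> a"
  shows "(real a - real b) ^ b \<le> fact b * real (a choose b)"
proof -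
  have "(real a - real b) ^ b = (\<Prod>i = 0..<b. real a - real b)" by simp
  also have "\<dots> \<le> (\<Prod>i = 0..<b. real a - real i)"
    using assms by (intro prod_mono) auto
  also have "\<dots> = fact b * real (a choose b)"
    using gbinomial_mult_fact[of b "real a"] by (simp add: binomial_gbinomial)
  finally show ?thesis .
qed

text \<open>
  Each of the \<open>2 * m - q\<close> linear factors of the count is at least \<open>min k n - 2 * m\<close>, so relative to its
  leading term the count is at least \<open>x ^ (2 * m - q)\<close> with \<open>x = (min k n - 2 * m) / n\<close>, and Bernoulli's
  inequality makes this linear in \<open>1 - x\<close>.  If \<open>x\<close> is negative, the claimed bound is at most \<open>0\<close>.
\<close>

lemma overlap_count_lower_bound:
  assumes "1 \<le> m" "q \<le> m" "1 \<le> n"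
  defines "r \<equiv> real (2 * m - q)"
  shows "overlap_limit m q (real n) * (1 - r * (2 * real m + \<bar>real k - real n\<bar>) / real n)
           \<le> overlap_count m q k n"
proof -
  define \<mu> where "\<mu> = min k n"
  define x where "x = (real \<mu> - 2 * real m) / real n"
  have r: "1 \<le> r" using assms by (simp add: r_def)
  have n: "0 < real n" using assms by simp
  have x1: "1 - r * (2 * real m + \<bar>real k - real n\<bar>) / real n \<le> 1 - r * (1 - x)"
  proof -
    have "1 - x \<le> (2 * real m + \<bar>real k - real n\<bar>) / real n"
    proof -
      have "1 - x = (2 * real m + (real n - real \<mu>)) / real n"
        using n by (simp add: x_def field_simps)
      also have "\<dots> \<le> (2 * real m + \<bar>real k - real n\<bar>) / real n"
        by (intro divide_right_mono) (auto simp: \<mu>_def)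
      finally show ?thesis .
    qed
    from mult_left_mono[OF this, of r] r show ?thesis by simp
  qed
  have L: "0 \<le> overlap_limit m q (real n)" by (simp add: overlap_limit_def)
  show ?thesis
  proof (cases "2 * m \<le> \<mu>")
    case True
    hence x0: "0 \<le> x" by (simp add: x_def)
    have M: "\<mu> \<le> max k n" by (simp add: \<mu>_def)
    have "(real n * x) ^ m \<le> (real \<mu> - real m) ^ m"
      using True n by (intro power_mono) (auto simp: x_def)
    also have "\<dots> \<le> fact m * real (\<mu> choose m)"
      using True by (intro power_le_falling_factorial) simp
    finally have 1: "(real n * x) ^ m \<le> fact m * real (\<mu> choose m)" .
    have "(real n * x) ^ (m - q) \<le> (real (max k n - m) - real (m - q)) ^ (m - q)"
      using True M n assms(2) by (intro power_mono) (auto simp: x_def)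
    also have "\<dots> \<le> fact (m - q) * real ((max k n - m) choose (m - q))"
      using True M by (intro power_le_falling_factorial) linarith
    finally have 2: "(real n * x) ^ (m - q) \<le> fact (m - q) * real ((max k n - m) choose (m - q))" .
    have "(real n * x) ^ (2 * m - q) = (real n * x) ^ m * (real n * x) ^ (m - q)"
      using assms(2) by (simp add: mult_2 flip: power_add)
    also have "\<dots> \<le> (fact m * real (\<mu> choose m)) * (fact (m - q) * real ((max k n - m) choose (m - q)))"
      using 1 2 x0 by (intro mult_mono) auto
    finally have "(real n * x) ^ (2 * m - q) \<le> (fact m * fact (m - q)) * overlap_count m q k n"
      by (simp add: overlap_count_def \<mu>_def mult_ac)
    hence "overlap_limit m q (real n) * x ^ (2 * m - q) \<le> overlap_count m q k n"
      by (simp add: overlap_limit_def field_simps)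
    moreover have "1 - r * (1 - x) \<le> x ^ (2 * m - q)"
      using Bernoulli_inequality[of "x - 1" "2 * m - q"] x0 by (simp add: r_def algebra_simps)
    ultimately show ?thesis
      using x1 L by (meson mult_left_mono order_trans)
  next
    case False
    hence "x < 0" using n by (simp add: x_def divide_less_0_iff)
    with r have "1 * 1 \<le> r * (1 - x)" by (intro mult_mono) auto
    with x1 L have "overlap_limit m q (real n) * (1 - r * (2 * real m + \<bar>real k - real n\<bar>) / real n) \<le> 0"
      by (intro mult_nonneg_nonpos) auto
    also have "0 \<le> overlap_count m q k n" by (simp add: overlap_count_def)
    finally show ?thesis .
  qed
qed

section \<open>Comparison of the Poissonized with the fixed sample size\<close>

context iid_kernel
begin

definition weight :: "nat \<Rightarrow> real" where
  "weight q = (fact m)\<^sup>2 * real (m choose q) * overlap_moment q"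

lemma weight_nonneg: "q \<le> m \<Longrightarrow> 0 \<le> weight q"
  by (simp add: weight_def overlap_moment_nonneg)

lemma W_mult_expectation:
  "expectation (\<lambda>\<omega>. W k \<omega> * W l \<omega>) = (\<Sum>q\<le>m. weight q * overlap_count m q k l)"
proof (cases "k \<le> l")
  case True
  thus ?thesis by (simp add: W_mult_expectation_le weight_def overlap_count_def)
next
  case False
  thus ?thesis
    using W_mult_expectation_le[of l k] by (simp add: weight_def overlap_count_def mult.commute)
qed

text \<open>
  Second moment of the statistic whose sample size is a Poisson variable with mean \<open>x\<close>, as the next
  lemma shows.
\<close>

definition mean_square :: "real \<Rightarrow> real" where
  "mean_square x = (\<Sum>q\<le>m. weight q * overlap_limit m q x)"

lemma poisson_mean_square:
  assumes "0 < rate"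
  shows "measure_pmf.expectation (poisson_pmf rate) (\<lambda>k. expectation (\<lambda>\<omega>. (W k \<omega>)\<^sup>2)) = mean_square rate"
  using assms
  by (simp add: power2_eq_square W_mult_expectation mean_square_def Bochner_Integration.integral_sum
      integrable_overlap_count_diagonal expectation_overlap_count_diagonal)

text \<open>
  Termwise comparison with \<open>mean_square\<close>, which is possible because the weights are nonnegative.
\<close>

lemma fixed_mean_square:
  assumes "1 \<le> m" "1 \<le> n"
  shows "expectation (\<lambda>\<omega>. (W n \<omega>)\<^sup>2) \<le> mean_square (real n)"
    and "(1 - 4 * (real m)\<^sup>2 / real n) * mean_square (real n) \<le> expectation (\<lambda>\<omega>. (W n \<omega>)\<^sup>2)"
proof -
  have eq: "expectation (\<lambda>\<omega>. (W n \<omega>)\<^sup>2) = (\<Sum>q\<le>m. weight q * overlap_count m q n n)"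
    by (simp add: power2_eq_square W_mult_expectation)
  show "expectation (\<lambda>\<omega>. (W n \<omega>)\<^sup>2) \<le> mean_square (real n)"
    unfolding eq mean_square_def
    by (intro sum_mono mult_left_mono overlap_count_diagonal_le weight_nonneg) auto
  show "(1 - 4 * (real m)\<^sup>2 / real n) * mean_square (real n) \<le> expectation (\<lambda>\<omega>. (W n \<omega>)\<^sup>2)"
    unfolding eq mean_square_def sum_distrib_left
  proof (rule sum_mono)
    fix q assume "q \<in> {..m}"
    hence q: "q \<le> m" by simp
    have "real (2 * m - q) * (2 * real m) \<le> (2 * real m) * (2 * real m)"
      by (intro mult_right_mono) auto
    hence "1 - 4 * (real m)\<^sup>2 / real n \<le> 1 - real (2 * m - q) * (2 * real m + \<bar>real n - real n\<bar>) / real n"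
      by (simp add: divide_right_mono power2_eq_square)
    moreover have "0 \<le> overlap_limit m q (real n)" by (simp add: overlap_limit_def)
    ultimately have "overlap_limit m q (real n) * (1 - 4 * (real m)\<^sup>2 / real n) \<le> overlap_count m q n n"
      using overlap_count_lower_bound[OF assms(1) q assms(2), of n] by (meson mult_left_mono order_trans)
    from mult_left_mono[OF this weight_nonneg[OF q]]
    show "(1 - 4 * (real m)\<^sup>2 / real n) * (weight q * overlap_limit m q (real n)) \<le> weight q * overlap_count m q n n"
      by (simp add: mult_ac)
  qed
qed

text \<open>
  After expanding the square, the weight of overlap \<open>q\<close> is multiplied by the counts at \<open>(k, k)\<close> and
  \<open>(n, n)\<close> minus twice the count at \<open>(k, n)\<close>.  The first has the leading term as its Poisson expectation, the second is at
  most the leading term, and the third is at least the leading term up to a relative error of order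
  \<open>(1 + \<bar>k - n\<bar>) / n\<close>, whose Poisson expectation is of order \<open>n\<close> to the power \<open>-1/2\<close>.
\<close>

lemma poisson_fixed_distance:
  assumes "1 \<le> m" "1 \<le> n"
  shows "measure_pmf.expectation (poisson_pmf (real n)) (\<lambda>k. expectation (\<lambda>\<omega>. (W k \<omega> - W n \<omega>)\<^sup>2))
           \<le> 4 * real m * (2 * real m + 1) * mean_square (real n) / sqrt (real n)"
proof -
  let ?P = "measure_pmf (poisson_pmf (real n))"
  let ?L = "\<lambda>q. overlap_limit m q (real n)"
  define e where "e q k = real (2 * m - q) * (2 * real m + \<bar>real k - real n\<bar>) / real n" for q k
  let ?F = "\<lambda>k. \<Sum>q\<le>m. weight q * (overlap_count m q k k - ?L q + 2 * ?L q * e q k)"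
  have n: "0 < real n" using assms by simp
  have L: "0 \<le> ?L q" for q by (simp add: overlap_limit_def)
  have bound: "expectation (\<lambda>\<omega>. (W k \<omega> - W n \<omega>)\<^sup>2) \<le> ?F k" for k
  proof -
    have "(\<lambda>\<omega>. (W k \<omega> - W n \<omega>)\<^sup>2) = (\<lambda>\<omega>. W k \<omega> * W k \<omega> - 2 * (W k \<omega> * W n \<omega>) + W n \<omega> * W n \<omega>)"
      by (auto simp: power2_eq_square algebra_simps)
    hence "expectation (\<lambda>\<omega>. (W k \<omega> - W n \<omega>)\<^sup>2)
        = expectation (\<lambda>\<omega>. W k \<omega> * W k \<omega>) - 2 * expectation (\<lambda>\<omega>. W k \<omega> * W n \<omega>) + expectation (\<lambda>\<omega>. W n \<omega> * W n \<omega>)"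
      by (simp add: W_mult_integrable)
    also have "\<dots> = (\<Sum>q\<le>m. weight q * (overlap_count m q k k - 2 * overlap_count m q k n + overlap_count m q n n))"
      by (simp add: W_mult_expectation sum_distrib_left algebra_simps sum.distrib sum_subtractf)
    also have "\<dots> \<le> ?F k"
    proof (intro sum_mono mult_left_mono weight_nonneg)
      fix q assume "q \<in> {..m}"
      hence q: "q \<le> m" by simp
      have "?L q * (1 - e q k) \<le> overlap_count m q k n"
        unfolding e_def by (rule overlap_count_lower_bound[OF assms(1) q assms(2)])
      moreover have "overlap_count m q n n \<le> ?L q" by (rule overlap_count_diagonal_le[OF q])
      moreover have "?L q * (1 - e q k) = ?L q - ?L q * e q k" by (simp only: right_diff_distrib mult_1_right)
      ultimately show "overlap_count m q k k - 2 * overlap_count m q k n + overlap_count m q n n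
          \<le> overlap_count m q k k - ?L q + 2 * ?L q * e q k" by linarith
    qed simp
    finally show ?thesis .
  qed
  have e_int: "integrable ?P (\<lambda>k. e q k)" for q
    unfolding e_def using integrable_poisson_deviation[OF n] by simp
  have e_le: "measure_pmf.expectation (poisson_pmf (real n)) (e q)
      \<le> 2 * real m * (2 * real m + 1) / sqrt (real n)" for q
  proof -
    have "measure_pmf.expectation (poisson_pmf (real n)) (e q)
        = real (2 * m - q) * (2 * real m + measure_pmf.expectation (poisson_pmf (real n)) (\<lambda>k. \<bar>real k - real n\<bar>)) / real n"
      unfolding e_def using integrable_poisson_deviation[OF n] by simp
    also have "\<dots> \<le> (2 * real m) * (2 * real m * sqrt (real n) + sqrt (real n)) / real n"
    proof (rule divide_right_mono[OF mult_mono])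
      have "2 * real m \<le> 2 * real m * sqrt (real n)"
        using assms(2) mult_left_mono[of 1 "sqrt (real n)" "2 * real m"] by simp
      thus "2 * real m + measure_pmf.expectation (poisson_pmf (real n)) (\<lambda>k. \<bar>real k - real n\<bar>)
          \<le> 2 * real m * sqrt (real n) + sqrt (real n)"
        using expectation_poisson_deviation[OF n] by (rule add_mono)
      show "0 \<le> 2 * real m + measure_pmf.expectation (poisson_pmf (real n)) (\<lambda>k. \<bar>real k - real n\<bar>)"
        by (intro add_nonneg_nonneg Bochner_Integration.integral_nonneg) auto
    qed auto
    also have "\<dots> = 2 * real m * (2 * real m + 1) * (sqrt (real n) / real n)"
      by (simp add: algebra_simps add_divide_distrib)
    also have "sqrt (real n) / real n = 1 / sqrt (real n)"
      using n by (simp add: field_simps)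
    finally show ?thesis by simp
  qed
  have int: "integrable ?P (\<lambda>k. weight q * (overlap_count m q k k - ?L q + 2 * ?L q * e q k))"
    if "q \<le> m" for q
    using e_int[of q] integrable_overlap_count_diagonal[OF n that] by simp
  have exp: "measure_pmf.expectation (poisson_pmf (real n))
        (\<lambda>k. weight q * (overlap_count m q k k - ?L q + 2 * ?L q * e q k))
      = weight q * (2 * ?L q * measure_pmf.expectation (poisson_pmf (real n)) (e q))"
    if "q \<le> m" for q
    using e_int[of q] integrable_overlap_count_diagonal[OF n that]
      expectation_overlap_count_diagonal[OF n that] by simp
  have "measure_pmf.expectation (poisson_pmf (real n)) (\<lambda>k. expectation (\<lambda>\<omega>. (W k \<omega> - W n \<omega>)\<^sup>2))
      \<le> measure_pmf.expectation (poisson_pmf (real n)) ?F"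
  proof (rule integral_mono')
    show "integrable ?P ?F" using int by (intro Bochner_Integration.integrable_sum) simp
    show "0 \<le> ?F k" for k
      by (rule order_trans[OF _ bound]) simp
  qed (rule bound)
  also have "\<dots> = (\<Sum>q\<le>m. measure_pmf.expectation (poisson_pmf (real n))
        (\<lambda>k. weight q * (overlap_count m q k k - ?L q + 2 * ?L q * e q k)))"
    using int by (intro Bochner_Integration.integral_sum) simp
  also have "\<dots> = (\<Sum>q\<le>m. weight q * (2 * ?L q * measure_pmf.expectation (poisson_pmf (real n)) (e q)))"
    using exp by (intro sum.cong refl) simp
  also have "\<dots> \<le> (\<Sum>q\<le>m. weight q * (2 * ?L q * (2 * real m * (2 * real m + 1) / sqrt (real n))))"
    using L by (intro sum_mono mult_left_mono e_le weight_nonneg) auto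
  also have "\<dots> = 4 * real m * (2 * real m + 1) * mean_square (real n) / sqrt (real n)"
    unfolding mean_square_def sum_distrib_left sum_divide_distrib
    by (intro sum.cong refl) (simp add: algebra_simps)
  finally show ?thesis .
qed

end

theorem lemma1p1:
  fixes M :: "'w measure" and S :: "'e measure"
    and X :: "nat \<Rightarrow> 'w \<Rightarrow> 'e" and N :: "nat \<Rightarrow> 'w \<Rightarrow> nat"
    and m :: nat and h :: "nat \<Rightarrow> (nat \<Rightarrow> 'e) \<Rightarrow> real"
    and U U' :: "nat \<Rightarrow> 'w \<Rightarrow> real"
  assumes "prob_space M"
    and X_indep: "prob_space.indep_vars M (\<lambda>_. S) X {1..}"
    and X_ident: "\<And>i. i \<ge> 1 \<Longrightarrow> distr M S (X i) = distr M S (X 1)"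
    and m: "m \<ge> 1"
    and h_kernel: "\<And>n. n \<ge> 1 \<Longrightarrow> symmetric_kernel S m (h n)"
    and h_mean: "\<And>n. n \<ge> 1 \<Longrightarrow> (\<integral>\<omega>. h n (\<lambda>j\<in>{1..m}. X j \<omega>) \<partial>M) = 0"
    and h_square: "\<And>n. n \<ge> 1 \<Longrightarrow> integrable M (\<lambda>\<omega>. (h n (\<lambda>j\<in>{1..m}. X j \<omega>))\<^sup>2)"
    and N_meas: "\<And>n. n \<ge> 1 \<Longrightarrow> N n \<in> measurable M (count_space UNIV)"
    and N_poisson: "\<And>n. n \<ge> 1 \<Longrightarrow>
           distr M (count_space UNIV) (N n) = measure_pmf (poisson_pmf (real n))"
    and N_X_indep: "indep_rvs M
           (PiM {1..} (\<lambda>_. count_space UNIV)) (\<lambda>\<omega>. \<lambda>n\<in>{1..}. N n \<omega>)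
           (PiM {1..} (\<lambda>_. S)) (\<lambda>\<omega>. \<lambda>i\<in>{1..}. X i \<omega>)"
    and U: "\<And>n \<omega>. n \<ge> m \<Longrightarrow> U n \<omega> = U_sum m (h n) (\<lambda>i. X i \<omega>) (N n \<omega>)"
    and U': "\<And>n \<omega>. n \<ge> m \<Longrightarrow> U' n \<omega> = U_sum m (h n) (\<lambda>i. X i \<omega>) n"
    and U_lim: "(\<lambda>n. \<integral>\<omega>. (U n \<omega>)\<^sup>2 \<partial>M) \<longlonglongrightarrow> 1"
  shows "(\<lambda>n. \<integral>\<omega>. (U' n \<omega>)\<^sup>2 \<partial>M) \<longlonglongrightarrow> 1 \<and>
         (\<lambda>n. \<integral>\<omega>. (U n \<omega> - U' n \<omega>)\<^sup>2 \<partial>M) \<in> O(\<lambda>n. real n powr (-1/2))"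
proof -
  interpret prob_space M by fact
  define Z where "Z \<omega> = (\<lambda>i\<in>{1..}. X i \<omega>)" for \<omega>
  define A where "A n = (\<integral>\<omega>. (U n \<omega>)\<^sup>2 \<partial>M)" for n
  define A' where "A' n = (\<integral>\<omega>. (U' n \<omega>)\<^sup>2 \<partial>M)" for n
  define D where "D n = (\<integral>\<omega>. (U n \<omega> - U' n \<omega>)\<^sup>2 \<partial>M)" for n
  \<comment> \<open>All error bounds are relative to \<open>A n\<close>, so the assumption on the limit of \<open>A\<close> enters only at the end.\<close>
  have bounds: "(1 - 4 * (real m)\<^sup>2 / real n) * A n \<le> A' n \<and> A' n \<le> A n \<and>
      D n \<le> 4 * real m * (2 * real m + 1) * A n / sqrt (real n)" if n: "m \<le> n" for n
  proof -
    have n1: "1 \<le> n" "0 < real n" using m n by auto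
    interpret k: iid_kernel M S X m "h n"
      by unfold_locales (fact X_indep, rule X_ident, assumption, fact h_kernel[OF n1(1)],
          fact h_square[OF n1(1)])
    have "indep_rvs M (count_space UNIV) (\<lambda>\<omega>. (\<lambda>n\<in>{1..}. N n \<omega>) n)
        (PiM {1..} (\<lambda>_. S)) (\<lambda>\<omega>. \<lambda>i\<in>{1..}. X i \<omega>)"
      using n1 by (intro indep_rvs_compose[OF N_X_indep] measurable_component_singleton) simp
    hence indep: "indep_rvs M (count_space UNIV) (N n) (PiM {1..} (\<lambda>_. S)) Z"
      using n1 unfolding Z_def[abs_def] by simp
    have W_restrict: "k.W l \<omega> = U_sum m (h n) (Z \<omega>) l" for l \<omega>
      unfolding k.W_def Z_def by (rule U_sum_cong) simp
    have U_measurable: "(\<lambda>x. U_sum m (h n) x l) \<in> borel_measurable (PiM {1..} (\<lambda>_. S))" for l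
      by (rule U_sum_measurable) (rule h_kernel[OF n1(1)])
    have "A n = (\<integral>\<omega>. (U_sum m (h n) (Z \<omega>) (N n \<omega>))\<^sup>2 \<partial>M)"
      by (simp add: A_def U[OF n] k.W_def[symmetric] W_restrict)
    also have "\<dots> = measure_pmf.expectation (poisson_pmf (real n))
        (\<lambda>l. expectation (\<lambda>\<omega>. (U_sum m (h n) (Z \<omega>) l)\<^sup>2))"
      using k.W_mult_integrable U_measurable
      by (intro expectation_random_index[OF indep N_poisson[OF n1(1)]] borel_measurable_power)
        (simp_all add: W_restrict power2_eq_square)
    finally have A: "A n = k.mean_square (real n)"
      using k.poisson_mean_square[OF n1(2)] by (simp add: W_restrict)
    have "D n = (\<integral>\<omega>. (U_sum m (h n) (Z \<omega>) (N n \<omega>) - U_sum m (h n) (Z \<omega>) n)\<^sup>2 \<partial>M)"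
      by (simp add: D_def U[OF n] U'[OF n] k.W_def[symmetric] W_restrict)
    also have "\<dots> = measure_pmf.expectation (poisson_pmf (real n))
        (\<lambda>l. expectation (\<lambda>\<omega>. (U_sum m (h n) (Z \<omega>) l - U_sum m (h n) (Z \<omega>) n)\<^sup>2))"
      using k.W_diff_square_integrable U_measurable
      by (intro expectation_random_index[OF indep N_poisson[OF n1(1)]] borel_measurable_power borel_measurable_diff)
        (simp_all add: W_restrict)
    finally have D: "D n = measure_pmf.expectation (poisson_pmf (real n))
        (\<lambda>l. expectation (\<lambda>\<omega>. (k.W l \<omega> - k.W n \<omega>)\<^sup>2))"
      by (simp add: W_restrict)
    have A': "A' n = expectation (\<lambda>\<omega>. (k.W n \<omega>)\<^sup>2)"
      by (simp add: A'_def U'[OF n] k.W_def)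
    show ?thesis
      using k.fixed_mean_square[OF m n1(1)] k.poisson_fixed_distance[OF m n1(1)]
      by (simp only: A A' D simp_thms)
  qed
  have A_lim: "A \<longlonglongrightarrow> 1" using U_lim by (simp add: A_def[abs_def])
  have lower_lim: "(\<lambda>n. (1 - 4 * (real m)\<^sup>2 / real n) * A n) \<longlonglongrightarrow> (1 - 0) * 1"
    by (intro tendsto_mult tendsto_diff tendsto_const A_lim lim_const_over_n)
  have "A' \<longlonglongrightarrow> 1"
  proof (rule tendsto_sandwich[OF _ _ _ A_lim])
    show "(\<lambda>n. (1 - 4 * (real m)\<^sup>2 / real n) * A n) \<longlonglongrightarrow> 1" using lower_lim by simp
    show "\<forall>\<^sub>F n in sequentially. (1 - 4 * (real m)\<^sup>2 / real n) * A n \<le> A' n"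
      "\<forall>\<^sub>F n in sequentially. A' n \<le> A n"
      using bounds by (auto intro: eventually_sequentiallyI[of m])
  qed
  moreover have "D \<in> O(\<lambda>n. real n powr (-1/2))"
  proof (rule bigoI)
    let ?c = "4 * real m * (2 * real m + 1)"
    have "\<forall>\<^sub>F n in sequentially. A n < 2"
      using A_lim by (rule order_tendstoD) simp
    moreover have "\<forall>\<^sub>F n in sequentially. m \<le> n" by (rule eventually_ge_at_top)
    ultimately show "\<forall>\<^sub>F n in sequentially. norm (D n) \<le> (?c * 2) * norm (real n powr (-1/2))"
    proof eventually_elim
      case (elim n)
      have n: "0 < real n" using elim m by simp
      have "0 \<le> D n" by (simp add: D_def)
      moreover have "?c * A n / sqrt (real n) \<le> ?c * 2 / sqrt (real n)"
        using elim by (intro divide_right_mono mult_left_mono) auto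
      hence "D n \<le> ?c * 2 / sqrt (real n)"
        using bounds[OF elim(2)] by linarith
      moreover have "norm (real n powr (-1/2)) = 1 / sqrt (real n)"
        using n by (simp add: powr_minus_divide powr_half_sqrt)
      ultimately show ?case by simp
    qed
  qed
  ultimately show ?thesis by (simp add: A'_def[abs_def] D_def[abs_def])
qed

end
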